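(* Let $R$ be a ring, $I$ an ideal of $R$ and $S=1+I$. Then the following statements are equivalent: (i) $I$ is an N-pure ideal of $R$. (ii) $\operatorname{Spec}(S^{-1}R)=\{S^{-1}\mathfrak{p} \mid \mathfrak{p}\in\operatorname{Spec}(R),\ I\subseteq\mathfrak{p}\}$. (iii) $N(S^{-1}R)=S^{-1}\sqrt{I}$. (iv) $\sqrt{I}=\sqrt{\operatorname{Ker}\varphi}$, where $\varphi: R\to S^{-1}R$ is the natural ring homomorphism. (v) $S^{-1}R/N(S^{-1}R)\cong R/\sqrt{I}$ as $R$-algebras.
   Context: All rings are commutative with identity. $N(A)$ denotes the nilradical of a ring $A$. An ideal $I$ of $R$ is called N-pure if for every $a\in I$ there exists $b\in I$ such that $a(1-b)\in N(R)$. $S=1+I=\{1+a \mid a\in I\}$ is a multiplicatively closed subset of $R$. For an ideal $K$ of $R$, $S^{-1}K$ denotes the extension of $K$ to $S^{-1}R$, and $\sqrt{K}$ the radical of $K$. *)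

theory Defs
  imports "HOL-Algebra.QuotRing"
begin

section \<open>Radicals, spectrum and N-pure ideals\<close>

definition radical_ideal :: "('a, 'b) ring_scheme \<Rightarrow> 'a set \<Rightarrow> 'a set"
  where "radical_ideal R K = {a \<in> carrier R. \<exists>n::nat. n > 0 \<and> a [^]\<^bsub>R\<^esub> n \<in> K}"

definition nilradical :: "('a, 'b) ring_scheme \<Rightarrow> 'a set"
  where "nilradical R = {a \<in> carrier R. \<exists>n::nat. n > 0 \<and> a [^]\<^bsub>R\<^esub> n = \<zero>\<^bsub>R\<^esub>}"

definition prime_spectrum :: "('a, 'b) ring_scheme \<Rightarrow> 'a set set"
  where "prime_spectrum R = {P. primeideal P R}"

definition N_pure_ideal :: "'a set \<Rightarrow> ('a, 'b) ring_scheme \<Rightarrow> bool"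
  where "N_pure_ideal I R \<longleftrightarrow>
    ideal I R \<and> (\<forall>a\<in>I. \<exists>b\<in>I. a \<otimes>\<^bsub>R\<^esub> (\<one>\<^bsub>R\<^esub> \<ominus>\<^bsub>R\<^esub> b) \<in> nilradical R)"


section \<open>Localization at a multiplicatively closed subset\<close>

text \<open>
  Elements of the localization are equivalence classes of pairs \<open>(r, s)\<close>. As for
  \<^const>\<open>rcoset_mult\<close>, an operation on classes is written as a union over all
  representatives; by \<open>localization_add\<close> and \<open>localization_mult\<close> below, the
  union collapses to a single class when \<open>S\<close> is multiplicatively closed.
\<close>

definition frac_rel :: "('a, 'b) ring_scheme \<Rightarrow> 'a set \<Rightarrow> (('a \<times> 'a) \<times> ('a \<times> 'a)) set"
  where "frac_rel R S = {((r, s), (r', s')).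
    r \<in> carrier R \<and> s \<in> S \<and> r' \<in> carrier R \<and> s' \<in> S \<and>
    (\<exists>t\<in>S. t \<otimes>\<^bsub>R\<^esub> (s' \<otimes>\<^bsub>R\<^esub> r \<ominus>\<^bsub>R\<^esub> s \<otimes>\<^bsub>R\<^esub> r') = \<zero>\<^bsub>R\<^esub>)}"

definition frac :: "('a, 'b) ring_scheme \<Rightarrow> 'a set \<Rightarrow> 'a \<Rightarrow> 'a \<Rightarrow> ('a \<times> 'a) set"
  where "frac R S r s = frac_rel R S `` {(r, s)}"

definition localization :: "('a, 'b) ring_scheme \<Rightarrow> 'a set \<Rightarrow> ('a \<times> 'a) set ring"
  where "localization R S =
    \<lparr>carrier = (carrier R \<times> S) // frac_rel R S,
     mult = (\<lambda>X Y. \<Union>(r, s)\<in>X. \<Union>(r', s')\<in>Y. frac R S (r \<otimes>\<^bsub>R\<^esub> r') (s \<otimes>\<^bsub>R\<^esub> s')),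
     one = frac R S \<one>\<^bsub>R\<^esub> \<one>\<^bsub>R\<^esub>,
     zero = frac R S \<zero>\<^bsub>R\<^esub> \<one>\<^bsub>R\<^esub>,
     add = (\<lambda>X Y. \<Union>(r, s)\<in>X. \<Union>(r', s')\<in>Y.
       frac R S (s' \<otimes>\<^bsub>R\<^esub> r \<oplus>\<^bsub>R\<^esub> s \<otimes>\<^bsub>R\<^esub> r') (s \<otimes>\<^bsub>R\<^esub> s'))\<rparr>"

definition localization_map :: "('a, 'b) ring_scheme \<Rightarrow> 'a set \<Rightarrow> 'a \<Rightarrow> ('a \<times> 'a) set"
  where "localization_map R S r = frac R S r \<one>\<^bsub>R\<^esub>"

text \<open>The extension of an ideal \<open>K\<close> along the canonical map, written \<open>S\<^sup>-\<^sup>1 K\<close>.\<close>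

definition localization_ideal :: "('a, 'b) ring_scheme \<Rightarrow> 'a set \<Rightarrow> 'a set \<Rightarrow> ('a \<times> 'a) set set"
  where "localization_ideal R S K = Idl\<^bsub>localization R S\<^esub> (localization_map R S ` K)"


section \<open>Isomorphisms of commutative algebras\<close>

text \<open>
  An algebra over a commutative ring \<open>R\<close> is a commutative ring \<open>A\<close> with a structure
  homomorphism \<open>\<alpha>\<close> from \<open>R\<close> to \<open>A\<close>, with scalar multiplication
  \<open>r \<cdot> x = \<alpha> r \<otimes> x\<close>. A ring isomorphism is \<open>R\<close>-linear iff it commutes with
  the structure homomorphisms.
\<close>

definition algebra_isomorphic ::
    "('r, 'x) ring_scheme \<Rightarrow> ('a, 'y) ring_scheme \<Rightarrow> ('r \<Rightarrow> 'a) \<Rightarrow>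
     ('b, 'z) ring_scheme \<Rightarrow> ('r \<Rightarrow> 'b) \<Rightarrow> bool"
  where "algebra_isomorphic R A \<alpha> B \<beta> \<longleftrightarrow>
    (\<exists>f. f \<in> ring_iso A B \<and> (\<forall>r\<in>carrier R. f (\<alpha> r) = \<beta> r))"


section \<open>The localization is a commutative ring\<close>

locale mult_closed = cring R + submonoid S R for R (structure) and S
begin

lemma S_carr [simp]: "s \<in> S \<Longrightarrow> s \<in> carrier R"
  using subset by blast

lemma frac_rel_trans:
  assumes c: "r \<in> carrier R" "r' \<in> carrier R" "r'' \<in> carrier R"
    "s \<in> carrier R" "s' \<in> carrier R" "s'' \<in> carrier R" "t \<in> carrier R" "u \<in> carrier R"
    and 1: "t \<otimes> (s' \<otimes> r \<ominus> s \<otimes> r') = \<zero>" and 2: "u \<otimes> (s'' \<otimes> r' \<ominus> s' \<otimes> r'') = \<zero>"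
  shows "(t \<otimes> u \<otimes> s') \<otimes> (s'' \<otimes> r \<ominus> s \<otimes> r'') = \<zero>"
proof -
  have "(t \<otimes> u \<otimes> s') \<otimes> (s'' \<otimes> r \<ominus> s \<otimes> r'') =
    (u \<otimes> s'') \<otimes> (t \<otimes> (s' \<otimes> r \<ominus> s \<otimes> r')) \<oplus> (t \<otimes> s) \<otimes> (u \<otimes> (s'' \<otimes> r' \<ominus> s' \<otimes> r''))"
    using c by algebra
  then show ?thesis using c by (simp add: 1 2)
qed

lemma frac_rel_sym:
  assumes c: "r \<in> carrier R" "r' \<in> carrier R" "s \<in> carrier R" "s' \<in> carrier R" "t \<in> carrier R"
    and 1: "t \<otimes> (s' \<otimes> r \<ominus> s \<otimes> r') = \<zero>"
  shows "t \<otimes> (s \<otimes> r' \<ominus> s' \<otimes> r) = \<zero>"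
proof -
  have "t \<otimes> (s \<otimes> r' \<ominus> s' \<otimes> r) = \<ominus> (t \<otimes> (s' \<otimes> r \<ominus> s \<otimes> r'))"
    using c by algebra
  then show ?thesis by (simp add: 1)
qed

lemma equiv_frac_rel: "equiv (carrier R \<times> S) (frac_rel R S)"
proof (rule equivI)
  show "frac_rel R S \<subseteq> (carrier R \<times> S) \<times> (carrier R \<times> S)"
    by (auto simp: frac_rel_def)
  have "\<one> \<otimes> (s \<otimes> r \<ominus> s \<otimes> r) = \<zero>" if "r \<in> carrier R" "s \<in> S" for r s
    using that by (simp add: minus_eq r_neg)
  then show "refl_on (carrier R \<times> S) (frac_rel R S)"
    unfolding refl_on_def frac_rel_def by (auto intro!: bexI[of _ \<one>])
  show "sym (frac_rel R S)"
  proof (rule symI)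
    fix x y assume "(x, y) \<in> frac_rel R S"
    then obtain r s r' s' t where e: "x = (r, s)" "y = (r', s')"
      and c: "r \<in> carrier R" "r' \<in> carrier R" "s \<in> S" "s' \<in> S" "t \<in> S"
      and 1: "t \<otimes> (s' \<otimes> r \<ominus> s \<otimes> r') = \<zero>"
      by (auto simp: frac_rel_def)
    have "t \<otimes> (s \<otimes> r' \<ominus> s' \<otimes> r) = \<zero>"
      by (rule frac_rel_sym[OF c(1,2) c(3-5)[THEN S_carr] 1])
    then show "(y, x) \<in> frac_rel R S"
      using c unfolding e frac_rel_def by blast
  qed
  show "trans (frac_rel R S)"
  proof (rule transI)
    fix x y z assume "(x, y) \<in> frac_rel R S" "(y, z) \<in> frac_rel R S"
    then obtain r s r' s' r'' s'' t u where
      e: "x = (r, s)" "y = (r', s')" "z = (r'', s'')"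
      and c: "r \<in> carrier R" "r' \<in> carrier R" "r'' \<in> carrier R"
        "s \<in> S" "s' \<in> S" "s'' \<in> S" "t \<in> S" "u \<in> S"
      and 1: "t \<otimes> (s' \<otimes> r \<ominus> s \<otimes> r') = \<zero>" and 2: "u \<otimes> (s'' \<otimes> r' \<ominus> s' \<otimes> r'') = \<zero>"
      by (auto simp: frac_rel_def)
    have "(t \<otimes> u \<otimes> s') \<otimes> (s'' \<otimes> r \<ominus> s \<otimes> r'') = \<zero>"
      using c 1 2 by (intro frac_rel_trans) auto
    moreover have "t \<otimes> u \<otimes> s' \<in> S" using c by simp
    ultimately show "(x, z) \<in> frac_rel R S"
      using c unfolding e frac_rel_def by blast
  qed
qed

lemma frac_eq_iff:
  assumes "r \<in> carrier R" "s \<in> S" "r' \<in> carrier R" "s' \<in> S"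
  shows "frac R S r s = frac R S r' s' \<longleftrightarrow> (\<exists>t\<in>S. t \<otimes> (s' \<otimes> r \<ominus> s \<otimes> r') = \<zero>)"
proof -
  have "frac R S r s = frac R S r' s' \<longleftrightarrow> ((r, s), (r', s')) \<in> frac_rel R S"
    unfolding frac_def using assms eq_equiv_class_iff[OF equiv_frac_rel] by auto
  then show ?thesis using assms by (simp add: frac_rel_def)
qed

lemma frac_eqI:
  assumes "r \<in> carrier R" "s \<in> S" "r' \<in> carrier R" "s' \<in> S" "s' \<otimes> r = s \<otimes> r'"
  shows "frac R S r s = frac R S r' s'"
proof -
  have "\<one> \<otimes> (s' \<otimes> r \<ominus> s \<otimes> r') = \<zero>"
    using assms by (simp add: minus_eq r_neg)
  then show ?thesis unfolding frac_eq_iff[OF assms(1-4)] using one_closed by (rule bexI)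
qed

lemma frac_closed [simp]:
  assumes "r \<in> carrier R" "s \<in> S"
  shows "frac R S r s \<in> carrier (localization R S)"
  using assms by (auto simp: localization_def frac_def intro: quotientI)

lemma localization_cases:
  assumes "x \<in> carrier (localization R S)"
  obtains r s where "r \<in> carrier R" "s \<in> S" "x = frac R S r s"
  using assms by (auto simp: localization_def frac_def elim!: quotientE)

lemma localization_mult:
  assumes "r \<in> carrier R" "s \<in> S" "r' \<in> carrier R" "s' \<in> S"
  shows "frac R S r s \<otimes>\<^bsub>localization R S\<^esub> frac R S r' s' = frac R S (r \<otimes> r') (s \<otimes> s')"
proof -
  have "congruent2 (frac_rel R S) (frac_rel R S)
      (\<lambda>x y. (\<lambda>(r, s). (\<lambda>(r', s'). frac R S (r \<otimes> r') (s \<otimes> s')) y) x)"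
  proof (rule congruent2_commuteI[OF equiv_frac_rel], goal_cases)
    case (1 y z)
    then show ?case by (auto simp: m_comm)
  next
    case (2 y z x)
    from 2 obtain r s where x: "x = (r, s)" "r \<in> carrier R" "s \<in> S" by auto
    from 2 obtain p q p' q' t where yz: "y = (p, q)" "z = (p', q')" "p \<in> carrier R" "q \<in> S"
      "p' \<in> carrier R" "q' \<in> S" "t \<in> S" "t \<otimes> (q' \<otimes> p \<ominus> q \<otimes> p') = \<zero>"
      by (auto simp: frac_rel_def)
    have "t \<otimes> ((s \<otimes> q') \<otimes> (r \<otimes> p) \<ominus> (s \<otimes> q) \<otimes> (r \<otimes> p')) =
      s \<otimes> r \<otimes> (t \<otimes> (q' \<otimes> p \<ominus> q \<otimes> p'))"
      using x(2) yz(3,5) x(3)[THEN S_carr] yz(4,6,7)[THEN S_carr] by algebra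
    also have "\<dots> = \<zero>" using x yz by simp
    finally show ?case using x yz by (auto simp: frac_eq_iff)
  qed
  from UN_equiv_class2[OF equiv_frac_rel equiv_frac_rel this, of "(r, s)" "(r', s')"] assms
  show ?thesis by (simp add: localization_def frac_def case_prod_beta)
qed

lemma localization_add:
  assumes "r \<in> carrier R" "s \<in> S" "r' \<in> carrier R" "s' \<in> S"
  shows "frac R S r s \<oplus>\<^bsub>localization R S\<^esub> frac R S r' s' =
    frac R S (s' \<otimes> r \<oplus> s \<otimes> r') (s \<otimes> s')"
proof -
  have "congruent2 (frac_rel R S) (frac_rel R S)
      (\<lambda>x y. (\<lambda>(r, s). (\<lambda>(r', s'). frac R S (s' \<otimes> r \<oplus> s \<otimes> r') (s \<otimes> s')) y) x)"
  proof (rule congruent2_commuteI[OF equiv_frac_rel], goal_cases)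
    case (1 y z)
    then show ?case by (auto simp: m_comm a_comm)
  next
    case (2 y z x)
    from 2 obtain r s where x: "x = (r, s)" "r \<in> carrier R" "s \<in> S" by auto
    from 2 obtain p q p' q' t where yz: "y = (p, q)" "z = (p', q')" "p \<in> carrier R" "q \<in> S"
      "p' \<in> carrier R" "q' \<in> S" "t \<in> S" "t \<otimes> (q' \<otimes> p \<ominus> q \<otimes> p') = \<zero>"
      by (auto simp: frac_rel_def)
    have "t \<otimes> ((s \<otimes> q') \<otimes> (q \<otimes> r \<oplus> s \<otimes> p) \<ominus> (s \<otimes> q) \<otimes> (q' \<otimes> r \<oplus> s \<otimes> p')) =
      s \<otimes> s \<otimes> (t \<otimes> (q' \<otimes> p \<ominus> q \<otimes> p'))"
      using x(2) yz(3,5) x(3)[THEN S_carr] yz(4,6,7)[THEN S_carr] by algebra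
    also have "\<dots> = \<zero>" using x yz by simp
    finally show ?case using x yz by (auto simp: frac_eq_iff)
  qed
  from UN_equiv_class2[OF equiv_frac_rel equiv_frac_rel this, of "(r, s)" "(r', s')"] assms
  show ?thesis by (simp add: localization_def frac_def case_prod_beta)
qed

lemma localization_one: "\<one>\<^bsub>localization R S\<^esub> = frac R S \<one> \<one>"
  and localization_zero: "\<zero>\<^bsub>localization R S\<^esub> = frac R S \<zero> \<one>"
  by (simp_all add: localization_def)

theorem localization_cring: "cring (localization R S)"
proof (rule cringI)
  show "abelian_group (localization R S)"
  proof (rule abelian_groupI, goal_cases)
    case (1 x y)
    then show ?case by (elim localization_cases) (simp add: localization_add)
  next
    case 2
    then show ?case by (simp add: localization_zero)
  next
    case (3 x y z)
    then obtain a b c d e f where "a \<in> carrier R" "b \<in> S" "c \<in> carrier R" "d \<in> S"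
      "e \<in> carrier R" "f \<in> S" and eq: "x = frac R S a b" "y = frac R S c d" "z = frac R S e f"
      by (elim localization_cases)
    note h = this(1-6) this(2,4,6)[THEN S_carr]
    have "f \<otimes> (d \<otimes> a \<oplus> b \<otimes> c) \<oplus> b \<otimes> d \<otimes> e = d \<otimes> f \<otimes> a \<oplus> b \<otimes> (f \<otimes> c \<oplus> d \<otimes> e)"
      using h by (simp add: r_distr m_ac a_ac)
    then show ?case using h by (simp add: eq localization_add m_assoc)
  next
    case (4 x y)
    then show ?case
      by (elim localization_cases) (simp add: localization_add m_comm a_comm)
  next
    case (5 x)
    then show ?case
      by (elim localization_cases) (simp add: localization_add localization_zero)
  next
    case (6 x)
    then obtain a b where h: "a \<in> carrier R" "b \<in> S" and eq: "x = frac R S a b"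
      by (elim localization_cases)
    have "frac R S (\<ominus> a) b \<oplus>\<^bsub>localization R S\<^esub> x = \<zero>\<^bsub>localization R S\<^esub>"
      unfolding eq localization_zero using h
      by (simp add: localization_add) (rule frac_eqI, simp_all add: r_minus l_neg)
    then show ?case using h by (meson frac_closed a_inv_closed)
  qed
  show "comm_monoid (localization R S)"
  proof (rule comm_monoidI, goal_cases)
    case (1 x y)
    then show ?case by (elim localization_cases) (simp add: localization_mult)
  next
    case 2
    then show ?case by (simp add: localization_one)
  next
    case (3 x y z)
    then show ?case by (elim localization_cases) (simp add: localization_mult m_assoc)
  next
    case (4 x)
    then show ?case by (elim localization_cases) (simp add: localization_mult localization_one)
  next
    case (5 x y)
    then show ?case by (elim localization_cases) (simp add: localization_mult m_comm)
  qed
  fix x y z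
  assume "x \<in> carrier (localization R S)" "y \<in> carrier (localization R S)"
    "z \<in> carrier (localization R S)"
  then obtain a b c d e f where "a \<in> carrier R" "b \<in> S" "c \<in> carrier R" "d \<in> S"
    "e \<in> carrier R" "f \<in> S" and eq: "x = frac R S a b" "y = frac R S c d" "z = frac R S e f"
    by (elim localization_cases)
  note h = this(1-6) this(2,4,6)[THEN S_carr]
  have "b \<otimes> f \<otimes> (d \<otimes> f) \<otimes> ((d \<otimes> a \<oplus> b \<otimes> c) \<otimes> e) =
    b \<otimes> d \<otimes> f \<otimes> (d \<otimes> f \<otimes> (a \<otimes> e) \<oplus> b \<otimes> f \<otimes> (c \<otimes> e))"
    using h by (simp add: r_distr l_distr m_ac a_ac)
  then show "(x \<oplus>\<^bsub>localization R S\<^esub> y) \<otimes>\<^bsub>localization R S\<^esub> z =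
      x \<otimes>\<^bsub>localization R S\<^esub> z \<oplus>\<^bsub>localization R S\<^esub> y \<otimes>\<^bsub>localization R S\<^esub> z"
    unfolding eq using h(1-6)
    by (simp add: localization_add localization_mult) (rule frac_eqI, simp_all)
qed

lemma localization_map_hom: "localization_map R S \<in> ring_hom R (localization R S)"
  by (rule ring_hom_memI)
    (auto simp: localization_map_def localization_add localization_mult localization_one)

lemma localization_map_Units:
  assumes "s \<in> S"
  shows "localization_map R S s \<in> Units (localization R S)"
proof -
  have "frac R S \<one> s \<otimes>\<^bsub>localization R S\<^esub> frac R S s \<one> = \<one>\<^bsub>localization R S\<^esub>"
    "frac R S s \<one> \<otimes>\<^bsub>localization R S\<^esub> frac R S \<one> s = \<one>\<^bsub>localization R S\<^esub>"
    using assms by (simp_all add: localization_mult localization_one) (rule frac_eqI; simp)+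
  then show ?thesis
    using assms unfolding Units_def localization_map_def
    by (smt (verit) S_carr frac_closed mem_Collect_eq one_closed cring_simprules(6))
qed

end

lemma mult_closed_one_plus_ideal:
  fixes R (structure)
  assumes "cring R" "ideal I R"
  shows "mult_closed R (\<one> <+ I)"
proof -
  interpret cring R by fact
  interpret ideal I R by fact
  have I: "a \<in> carrier R" if "a \<in> I" for a using that by (rule a_Hcarr)
  have mem: "x \<in> \<one> <+ I \<longleftrightarrow> (\<exists>a\<in>I. x = \<one> \<oplus> a)" for x
    by (auto simp: a_l_coset_def l_coset_def)
  have "submonoid (\<one> <+ I) R"
  proof
    show "\<one> <+ I \<subseteq> carrier R" using I by (auto simp: mem)
    show "\<one> \<in> \<one> <+ I" unfolding mem by (rule bexI[of _ \<zero>]) auto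
    fix x y assume "x \<in> \<one> <+ I" "y \<in> \<one> <+ I"
    then obtain a b where ab: "a \<in> I" "b \<in> I" "x = \<one> \<oplus> a" "y = \<one> \<oplus> b"
      by (auto simp: mem)
    have "x \<otimes> y = \<one> \<oplus> (a \<oplus> b \<oplus> a \<otimes> b)"
      unfolding ab(3,4) using ab(1,2)[THEN I] by algebra
    moreover have "a \<oplus> b \<oplus> a \<otimes> b \<in> I"
      using ab(1,2) I by (simp add: I_l_closed)
    ultimately show "x \<otimes> y \<in> \<one> <+ I" unfolding mem by blast
  qed
  then show ?thesis by (simp add: mult_closed_def cring_axioms)
qed

end

theory Submission
  imports "HOL-Algebra.Ring_Divisibility" Defs
begin

text \<open>
  All the conditions are compared with a single one: the canonical map \<open>\<phi>\<close> from \<open>R\<close> to its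
  localization sends \<open>I\<close> into the nilradical. Since \<open>\<phi> a\<close> is nilpotent iff some power of \<open>a\<close> is
  annihilated by an element of \<open>1 + I\<close>, that is, by some \<open>1 - b\<close> with \<open>b \<in> I\<close>, this is
  N-purity: an identity \<open>(1 - b) a\<^sup>n = 0\<close> and the nilpotency of \<open>a (1 - b)\<close> differ
  only by powers of \<open>1 - b\<close>, which again have the form \<open>1 - b'\<close>
  (\<open>N_pure_iff_map_nilpotent\<close>).

  Two facts hold for every ideal \<open>I\<close>. First, the kernel of \<open>\<phi>\<close> lies in \<open>I\<close>, as
  \<open>(1 - b) r = 0\<close> means \<open>r = b r\<close>. The inclusion of the radical of the kernel in the radical
  of \<open>I\<close> is therefore automatic, and the converse inclusion says that \<open>\<phi>\<close> maps \<open>I\<close> to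
  nilpotents. Second, a prime containing \<open>I\<close> avoids \<open>1 + I\<close> and hence extends to a prime of
  the localization.

  The other equivalences follow. Every ideal of a localization is the extension of its
  contraction, and the nilradical contracts to the radical of the kernel; this translates
  the kernel condition into the one on the nilradical. As the nilradical is
  the intersection of all primes, \<open>\<phi>\<close> maps \<open>I\<close> to nilpotents iff every prime of the localization
  contains the image of \<open>I\<close>, that is, iff its contraction contains \<open>I\<close>. Finally,
  \<open>r / (1 - b) = b r / (1 - b) + r / 1\<close>, so modulo nilpotents every fraction comes from \<open>R\<close>
  once \<open>\<phi>\<close> maps \<open>I\<close> to nilpotents; the quotient of the localization is then a
  quotient of \<open>R\<close>. Conversely an isomorphism of algebras kills in the source whatever is killed
  in the target, in particular \<open>I\<close>.
\<close>

section \<open>Radicals and prime ideals\<close>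

text \<open>
  An ideal maximal among those that avoid \<open>T\<close> is prime: if \<open>a\<close> and \<open>b\<close> lie outside it, adjoining
  either makes it meet \<open>T\<close>, and the product of the two elements of \<open>T\<close> lies in the ideal
  as soon as \<open>a b\<close> does.
\<close>

lemma (in cring) exists_prime_disjoint:
  assumes K: "ideal K R" and T: "submonoid T R" and KT: "K \<inter> T = {}"
  shows "\<exists>P. primeideal P R \<and> K \<subseteq> P \<and> P \<inter> T = {}"
proof -
  let ?A = "{J. ideal J R \<and> K \<subseteq> J \<and> J \<inter> T = {}}"
  have "\<exists>M\<in>?A. \<forall>X\<in>?A. M \<subseteq> X \<longrightarrow> X = M"
  proof (rule subset_Zorn_nonempty)
    show "?A \<noteq> {}" using K KT by blast
  next
    fix C assume C: "C \<noteq> {}" "subset.chain ?A C"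
    then have "subset.chain {J. ideal J R} C" by (auto simp: subset_chain_def)
    then have "ideal (\<Union>C) R" using chain_Union_is_ideal[of C] C(1) by simp
    then show "\<Union>C \<in> ?A" using C by (fastforce simp: subset_chain_def)
  qed
  then obtain M where MA: "M \<in> ?A" and maxA: "\<forall>X\<in>?A. M \<subseteq> X \<longrightarrow> X = M" by (rule bexE)
  then have M: "ideal M R" "K \<subseteq> M" "M \<inter> T = {}" by simp_all
  have max: "X = M" if "ideal X R" "M \<subseteq> X" "X \<inter> T = {}" for X
    using maxA that M(2) by (metis (mono_tags, lifting) mem_Collect_eq order_trans)
  interpret M: ideal M R by fact
  interpret T: submonoid T R by fact
  have meets: "\<exists>m\<in>M. \<exists>x\<in>carrier R. m \<oplus> x \<otimes> a \<in> T" if a: "a \<in> carrier R" "a \<notin> M" for a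
  proof -
    let ?X = "set_add R M (PIdl a)"
    have X: "ideal ?X R" using add_ideals[OF M(1) cgenideal_ideal[OF a(1)]] .
    have "m \<in> ?X" if "m \<in> M" for m
    proof -
      have "m = m \<oplus> \<zero> \<otimes> a" using that a(1) by simp
      then show ?thesis using that unfolding set_add_def' cgenideal_def by blast
    qed
    moreover have "a = \<zero> \<oplus> \<one> \<otimes> a" using a(1) by simp
    then have "a \<in> ?X" unfolding set_add_def' cgenideal_def using M.zero_closed by blast
    ultimately have "?X \<inter> T \<noteq> {}" using max[OF X] a(2) by blast
    then show ?thesis unfolding set_add_def' cgenideal_def by auto
  qed
  have "primeideal M R"
  proof (rule primeidealI[OF M(1) is_cring])
    show "carrier R \<noteq> M" using M(3) T.one_closed by auto
  next
    fix a b assume ab: "a \<in> carrier R" "b \<in> carrier R" "a \<otimes> b \<in> M"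
    show "a \<in> M \<or> b \<in> M"
    proof (rule ccontr)
      assume "\<not> (a \<in> M \<or> b \<in> M)"
      then obtain m x n y where h: "m \<in> M" "x \<in> carrier R" "m \<oplus> x \<otimes> a \<in> T"
        "n \<in> M" "y \<in> carrier R" "n \<oplus> y \<otimes> b \<in> T"
        using meets ab(1,2) by metis
      have "(m \<oplus> x \<otimes> a) \<otimes> (n \<oplus> y \<otimes> b) =
          m \<otimes> (n \<oplus> y \<otimes> b) \<oplus> (x \<otimes> a) \<otimes> n \<oplus> (x \<otimes> y) \<otimes> (a \<otimes> b)"
        using h(2,5) h(1,4)[THEN M.Icarr] ab(1,2) by algebra
      also have "\<dots> \<in> M"
        using h(2,5) h(1,4) h(1,4)[THEN M.Icarr] ab by (simp add: M.I_l_closed M.I_r_closed)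
      finally show False using T.m_closed[OF h(3,6)] M(3) by blast
    qed
  qed
  then show ?thesis using M by blast
qed

lemma (in primeideal) pow_mem_imp_mem:
  assumes "a \<in> carrier R" "a [^] (n::nat) \<in> I"
  shows "a \<in> I"
  using assms(2)
proof (induction n)
  case 0
  then show ?case using one_imp_carrier I_notcarr by simp
next
  case (Suc n)
  then show ?case using I_prime[of "a [^] n" a] assms(1) by auto
qed

lemma (in cring) submonoid_powers:
  assumes a: "a \<in> carrier R"
  shows "submonoid (range (\<lambda>n::nat. a [^] n)) R"
proof
  show "range (\<lambda>n::nat. a [^] n) \<subseteq> carrier R" using a by auto
  show "\<one> \<in> range (\<lambda>n::nat. a [^] n)" by (rule range_eqI[of _ _ 0]) simp
  fix x y assume "x \<in> range (\<lambda>n::nat. a [^] n)" "y \<in> range (\<lambda>n::nat. a [^] n)"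
  then show "x \<otimes> y \<in> range (\<lambda>n::nat. a [^] n)" using a by (auto simp: nat_pow_mult)
qed

text \<open>
  If no power of \<open>a\<close> lies in \<open>K\<close>, some prime containing \<open>K\<close> avoids the powers of \<open>a\<close>. Inserting
  \<open>carrier R\<close> gives the right value when no prime contains \<open>K\<close>.
\<close>

lemma (in cring) radical_ideal_eq_Inter_primes:
  assumes K: "ideal K R"
  shows "radical_ideal R K = \<Inter>(insert (carrier R) {P. primeideal P R \<and> K \<subseteq> P})"
proof (intro equalityI subsetI)
  fix a assume "a \<in> radical_ideal R K"
  then show "a \<in> \<Inter>(insert (carrier R) {P. primeideal P R \<and> K \<subseteq> P})"
    by (auto simp: radical_ideal_def intro: primeideal.pow_mem_imp_mem)
next
  fix a assume a: "a \<in> \<Inter>(insert (carrier R) {P. primeideal P R \<and> K \<subseteq> P})"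
  then have ac: "a \<in> carrier R" by simp
  \<comment> \<open>The powers include the zeroth one, while the radical asks for a positive exponent;
    multiplying by \<open>a\<close> once more bridges the gap.\<close>
  have "a [^] (1::nat) \<in> range (\<lambda>n::nat. a [^] n)" by (rule rangeI)
  then have "a \<in> range (\<lambda>n::nat. a [^] n)" using ac by simp
  then have "K \<inter> range (\<lambda>n::nat. a [^] n) \<noteq> {}"
    using exists_prime_disjoint[OF K submonoid_powers[OF ac]] a by blast
  then obtain n :: nat where n: "a [^] n \<in> K" by auto
  then have "a [^] Suc n \<in> K" using ac by (simp add: ideal.I_r_closed[OF K])
  then show "a \<in> radical_ideal R K" using ac unfolding radical_ideal_def by blast
qed

text \<open>Closure under addition comes from the primes, without expanding powers of a sum.\<close>

lemma (in cring) ideal_radical_ideal: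
  assumes K: "ideal K R"
  shows "ideal (radical_ideal R K) R"
  unfolding radical_ideal_eq_Inter_primes[OF K]
  by (rule i_Intersect) (auto simp: oneideal primeideal.axioms)

lemma nilradical_eq_radical_zero: "nilradical R = radical_ideal R {\<zero>\<^bsub>R\<^esub>}"
  by (simp add: nilradical_def radical_ideal_def)

lemma (in cring) ideal_nilradical: "ideal (nilradical R) R"
  by (simp add: nilradical_eq_radical_zero ideal_radical_ideal zeroideal)

lemma (in ring) ideal_subset_radical: 
  assumes "ideal K R" shows "K \<subseteq> radical_ideal R K"
proof
  fix a assume "a \<in> K"
  then have "a \<in> carrier R" "a [^] (1::nat) \<in> K" using ideal.Icarr[OF assms] by auto
  then show "a \<in> radical_ideal R K" unfolding radical_ideal_def by (blast intro: zero_less_one)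
qed

lemma (in cring) radical_subset_radical_iff:
  assumes K: "ideal K R" and L: "ideal L R"
  shows "radical_ideal R K \<subseteq> radical_ideal R L \<longleftrightarrow> K \<subseteq> radical_ideal R L"
proof
  show "K \<subseteq> radical_ideal R L" if "radical_ideal R K \<subseteq> radical_ideal R L"
    using that ideal_subset_radical[OF K] by blast
next
  assume "K \<subseteq> radical_ideal R L"
  then show "radical_ideal R K \<subseteq> radical_ideal R L"
    unfolding radical_ideal_eq_Inter_primes[OF K] radical_ideal_eq_Inter_primes[OF L] by blast
qed

section \<open>The first isomorphism theorem for algebras\<close>

lemma (in ring_hom_ring) algebra_isomorphic_Quot_kernel:
  assumes surj: "h ` carrier R = carrier S"
  shows "algebra_isomorphic R S h (R Quot a_kernel R S h) (\<lambda>r. a_kernel R S h +> r)"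
proof -
  let ?K = "a_kernel R S h" let ?g = "\<lambda>X. the_elem (h ` X)"
  have g: "?g \<in> ring_iso (R Quot ?K) S" using FactRing_iso_set[OF surj] .
  interpret Q: ring "R Quot ?K" using ideal.quotient_is_ring[OF kernel_is_ideal] .
  have "inv_into (carrier (R Quot ?K)) ?g \<in> ring_iso S (R Quot ?K)"
    using ring_iso_set_sym[OF Q.ring_axioms g] .
  moreover have "inv_into (carrier (R Quot ?K)) ?g (h r) = ?K +> r" if r: "r \<in> carrier R" for r
  proof (rule inv_into_f_eq)
    show "inj_on ?g (carrier (R Quot ?K))" using g by (simp add: ring_iso_def bij_betw_def)
    show "?K +> r \<in> carrier (R Quot ?K)"
      using ideal.rcos_ring_hom[OF kernel_is_ideal] r by (auto dest: ring_hom_closed)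
    show "?g (?K +> r) = h r" using r by simp
  qed
  ultimately show ?thesis unfolding algebra_isomorphic_def by blast
qed

section \<open>Ideals of a localization\<close>

context mult_closed
begin

abbreviation "SR \<equiv> localization R S"
abbreviation "\<phi> \<equiv> localization_map R S"

sublocale L: cring SR by (rule localization_cring)
sublocale \<phi>: ring_hom_ring R SR \<phi>
  by (rule ring_hom_ringI2) (simp_all add: ring_axioms L.ring_axioms localization_map_hom)

text \<open>Numerator and fraction differ by a unit, so an ideal contains both or neither.\<close>

lemma frac_mem_ideal_iff:
  assumes J: "ideal J SR" and r: "r \<in> carrier R" and s: "s \<in> S"
  shows "frac R S r s \<in> J \<longleftrightarrow> \<phi> r \<in> J"
proof
  assume "frac R S r s \<in> J"
  moreover have "frac R S r s \<otimes>\<^bsub>SR\<^esub> \<phi> s = \<phi> r"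
    using r s unfolding localization_map_def
    by (simp add: localization_mult) (rule frac_eqI; simp add: m_comm)
  ultimately show "\<phi> r \<in> J"
    using ideal.I_r_closed[OF J] s S_carr \<phi>.hom_closed by metis
next
  assume "\<phi> r \<in> J"
  moreover have "\<phi> r \<otimes>\<^bsub>SR\<^esub> frac R S \<one> s = frac R S r s"
    using r s unfolding localization_map_def by (simp add: localization_mult)
  ultimately show "frac R S r s \<in> J"
    using ideal.I_r_closed[OF J] s frac_closed S_carr[OF one_closed] by metis
qed

lemma localization_ideal_eq:
  assumes K: "ideal K R"
  shows "localization_ideal R S K = {frac R S r s | r s. r \<in> K \<and> s \<in> S}"
    (is "_ = ?E")
proof
  interpret K: ideal K R by fact
  have Kc: "\<phi> ` K \<subseteq> carrier SR" using K.Icarr by auto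
  have "ideal ?E SR"
  proof (rule idealI[OF L.ring_axioms])
    show "subgroup ?E (add_monoid SR)"
    proof (rule L.add.subgroupI)
      show "?E \<subseteq> carrier SR" using K.Icarr by auto
      show "?E \<noteq> {}" using K.zero_closed one_closed by blast
    next
      fix x assume "x \<in> ?E"
      then obtain r s where rs: "r \<in> K" "s \<in> S" "x = frac R S r s" by blast
      have "frac R S (\<ominus> r) s \<oplus>\<^bsub>SR\<^esub> x = \<zero>\<^bsub>SR\<^esub>"
        unfolding rs(3) localization_zero using rs(1,2) K.Icarr
        by (simp add: localization_add) (rule frac_eqI, simp_all add: r_minus l_neg)
      then have "\<ominus>\<^bsub>SR\<^esub> x = frac R S (\<ominus> r) s"
        using rs K.Icarr by (intro L.minus_equality) auto
      then show "\<ominus>\<^bsub>SR\<^esub> x \<in> ?E" using rs by auto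
    next
      fix x y assume "x \<in> ?E" "y \<in> ?E"
      then obtain r s r' s' where h: "r \<in> K" "s \<in> S" "x = frac R S r s"
        "r' \<in> K" "s' \<in> S" "y = frac R S r' s'" by blast
      have "x \<oplus>\<^bsub>SR\<^esub> y = frac R S (s' \<otimes> r \<oplus> s \<otimes> r') (s \<otimes> s')"
        using h K.Icarr by (simp add: localization_add)
      moreover have "s' \<otimes> r \<oplus> s \<otimes> r' \<in> K" using h by (simp add: K.I_l_closed)
      ultimately show "x \<oplus>\<^bsub>SR\<^esub> y \<in> ?E" using h by blast
    qed
  next
    fix x y assume x: "x \<in> ?E" and y: "y \<in> carrier SR"
    obtain r s where rs: "r \<in> K" "s \<in> S" "x = frac R S r s" using x by blast
    obtain r' s' where rs': "r' \<in> carrier R" "s' \<in> S" "y = frac R S r' s'"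
      using y by (rule localization_cases)
    note h = rs rs'
    have "y \<otimes>\<^bsub>SR\<^esub> x = frac R S (r' \<otimes> r) (s' \<otimes> s)"
      using h K.Icarr by (simp add: localization_mult)
    moreover have "r' \<otimes> r \<in> K" "s' \<otimes> s \<in> S" using h by (simp_all add: K.I_l_closed)
    ultimately show yx: "y \<otimes>\<^bsub>SR\<^esub> x \<in> ?E" by blast
    have "x \<in> carrier SR" using h K.Icarr by simp
    then have "x \<otimes>\<^bsub>SR\<^esub> y = y \<otimes>\<^bsub>SR\<^esub> x" using y by (rule L.m_comm)
    then show "x \<otimes>\<^bsub>SR\<^esub> y \<in> ?E" using yx by (simp only:)
  qed
  moreover have "\<phi> ` K \<subseteq> ?E"
  proof (rule image_subsetI)
    fix r assume "r \<in> K"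
    then have "frac R S r \<one> \<in> ?E" using one_closed by blast
    then show "\<phi> r \<in> ?E" by (simp only: localization_map_def)
  qed
  ultimately show "localization_ideal R S K \<subseteq> ?E"
    unfolding localization_ideal_def by (rule L.genideal_minimal)
  have J: "ideal (localization_ideal R S K) SR" and sub: "\<phi> ` K \<subseteq> localization_ideal R S K"
    unfolding localization_ideal_def
    using L.genideal_ideal[OF Kc] L.genideal_self[OF Kc] by simp_all
  show "?E \<subseteq> localization_ideal R S K"
  proof
    fix x assume "x \<in> ?E"
    then obtain r s where rs: "r \<in> K" "s \<in> S" "x = frac R S r s" by blast
    then show "x \<in> localization_ideal R S K"
      using frac_mem_ideal_iff[OF J K.Icarr[OF rs(1)] rs(2)] sub by blast
  qed
qed

lemma extension_of_contraction:
  assumes J: "ideal J SR"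
  shows "localization_ideal R S {r \<in> carrier R. \<phi> r \<in> J} = J"
proof
  show "localization_ideal R S {r \<in> carrier R. \<phi> r \<in> J} \<subseteq> J"
    unfolding localization_ideal_def by (rule L.genideal_minimal[OF J]) blast
next
  let ?K = "{r \<in> carrier R. \<phi> r \<in> J}"
  have sub: "\<phi> ` ?K \<subseteq> carrier SR" by auto
  have E: "ideal (localization_ideal R S ?K) SR" "\<phi> ` ?K \<subseteq> localization_ideal R S ?K"
    unfolding localization_ideal_def using L.genideal_ideal[OF sub] L.genideal_self[OF sub] by auto
  show "J \<subseteq> localization_ideal R S ?K"
  proof
    fix x assume x: "x \<in> J"
    then have "x \<in> carrier SR" using ideal.Icarr[OF J] by simp
    then obtain r s where rs: "r \<in> carrier R" "s \<in> S" "x = frac R S r s"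
      by (elim localization_cases)
    then have "\<phi> r \<in> J" using x frac_mem_ideal_iff[OF J] by simp
    then show "x \<in> localization_ideal R S ?K"
      using E rs frac_mem_ideal_iff[OF E(1)] by blast
  qed
qed

text \<open>
  A fraction in the extension equals some fraction with numerator in \<open>P\<close>; for its own numerator
  this only gives membership in \<open>P\<close> after multiplication by an element of \<open>S\<close>, which
  primality and disjointness from \<open>S\<close> allow to cancel.
\<close>

lemma frac_mem_prime_extension_iff:
  assumes P: "primeideal P R" and PS: "P \<inter> S = {}" and r: "r \<in> carrier R" and s: "s \<in> S"
  shows "frac R S r s \<in> localization_ideal R S P \<longleftrightarrow> r \<in> P"
proof
  interpret P: primeideal P R by fact
  assume "frac R S r s \<in> localization_ideal R S P"
  then obtain r' s' where h: "r' \<in> P" "s' \<in> S" "frac R S r s = frac R S r' s'"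
    unfolding localization_ideal_eq[OF P.is_ideal] by blast
  then obtain t where t: "t \<in> S" "t \<otimes> (s' \<otimes> r \<ominus> s \<otimes> r') = \<zero>"
    using frac_eq_iff[OF r s P.Icarr[OF h(1)] h(2)] by blast
  have "(t \<otimes> s') \<otimes> r = t \<otimes> (s' \<otimes> r \<ominus> s \<otimes> r') \<oplus> (t \<otimes> s) \<otimes> r'"
    using t(1)[THEN S_carr] s[THEN S_carr] h(2)[THEN S_carr] r P.Icarr[OF h(1)] by algebra
  also have "\<dots> \<in> P" using t s h(1) by (simp add: P.Icarr P.I_l_closed)
  finally have "t \<otimes> s' \<in> P \<or> r \<in> P" using P.I_prime t(1) h(2) r by simp
  moreover have "t \<otimes> s' \<notin> P" using t(1) h(2) PS by auto
  ultimately show "r \<in> P" by simp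
next
  assume "r \<in> P"
  then show "frac R S r s \<in> localization_ideal R S P"
    using s unfolding localization_ideal_eq[OF primeideal.axioms(1)[OF P]] by blast
qed

lemma primeideal_extension:
  assumes P: "primeideal P R" and PS: "P \<inter> S = {}"
  shows "primeideal (localization_ideal R S P) SR"
proof (rule primeidealI[OF _ L.is_cring])
  have "\<phi> ` P \<subseteq> carrier SR"
    using ideal.Icarr[OF primeideal.axioms(1)[OF P]] by (intro image_subsetI \<phi>.hom_closed)
  then show "ideal (localization_ideal R S P) SR"
    unfolding localization_ideal_def by (rule L.genideal_ideal)
  have "\<one>\<^bsub>SR\<^esub> \<notin> localization_ideal R S P"
    using PS one_closed by (auto simp: localization_one frac_mem_prime_extension_iff[OF P PS])
  then show "carrier SR \<noteq> localization_ideal R S P" using L.one_closed by blast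
next
  fix x y assume xy: "x \<in> carrier SR" "y \<in> carrier SR" "x \<otimes>\<^bsub>SR\<^esub> y \<in> localization_ideal R S P"
  then obtain r s r' s' where h: "r \<in> carrier R" "s \<in> S" "x = frac R S r s"
    "r' \<in> carrier R" "s' \<in> S" "y = frac R S r' s'" by (elim localization_cases)
  have "r \<otimes> r' \<in> P"
    using xy(3) h frac_mem_prime_extension_iff[OF P PS] by (simp add: localization_mult)
  then show "x \<in> localization_ideal R S P \<or> y \<in> localization_ideal R S P"
    using h primeideal.I_prime[OF P] by (auto simp: frac_mem_prime_extension_iff[OF P PS])
qed

lemma mem_kernel_iff:
  assumes "r \<in> carrier R"
  shows "r \<in> a_kernel R SR \<phi> \<longleftrightarrow> (\<exists>t\<in>S. t \<otimes> r = \<zero>)"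
proof -
  have "\<phi> r = \<zero>\<^bsub>SR\<^esub> \<longleftrightarrow> (\<exists>t\<in>S. t \<otimes> (\<one> \<otimes> r \<ominus> \<one> \<otimes> \<zero>) = \<zero>)"
    unfolding localization_map_def localization_zero
    by (rule frac_eq_iff[OF assms one_closed zero_closed one_closed])
  moreover have "\<one> \<otimes> r \<ominus> \<one> \<otimes> \<zero> = r" using assms by algebra
  ultimately show ?thesis unfolding a_kernel_def' using assms by simp
qed

lemma map_mem_nilradical_iff:
  assumes "r \<in> carrier R"
  shows "\<phi> r \<in> nilradical SR \<longleftrightarrow> r \<in> radical_ideal R (a_kernel R SR \<phi>)"
proof -
  have "\<phi> r [^]\<^bsub>SR\<^esub> n = \<zero>\<^bsub>SR\<^esub> \<longleftrightarrow> r [^] n \<in> a_kernel R SR \<phi>" for n :: nat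
    unfolding \<phi>.hom_nat_pow[OF assms, symmetric] a_kernel_def'
    using nat_pow_closed[OF assms] by blast
  then show ?thesis
    unfolding nilradical_def radical_ideal_def using assms \<phi>.hom_closed[OF assms] by blast
qed

lemma contraction_nilradical:
  "{r \<in> carrier R. \<phi> r \<in> nilradical SR} = radical_ideal R (a_kernel R SR \<phi>)"
proof -
  have "radical_ideal R (a_kernel R SR \<phi>) \<subseteq> carrier R" unfolding radical_ideal_def by blast
  then show ?thesis using map_mem_nilradical_iff by blast
qed

end

section \<open>Localization at \<open>1 + I\<close>\<close>

locale one_plus_ideal = cring R + ideal I R for R (structure) and I

sublocale one_plus_ideal \<subseteq> mult_closed R "\<one> <+ I"
  using mult_closed_one_plus_ideal[OF is_cring is_ideal] .

context one_plus_ideal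
begin

abbreviation "S \<equiv> \<one> <+ I"

text \<open>The sign matches the factor \<open>1 - b\<close> in the definition of N-purity.\<close>

lemma mem_S_iff: "s \<in> S \<longleftrightarrow> (\<exists>b\<in>I. s = \<one> \<ominus> b)"
proof
  assume "s \<in> S"
  then obtain a where a: "a \<in> I" "s = \<one> \<oplus> a" by (auto simp: a_l_coset_def l_coset_def)
  then have "s = \<one> \<ominus> (\<ominus> a)" by (simp add: minus_eq)
  then show "\<exists>b\<in>I. s = \<one> \<ominus> b" using a by blast
next
  assume "\<exists>b\<in>I. s = \<one> \<ominus> b"
  then obtain b where "b \<in> I" "s = \<one> \<oplus> (\<ominus> b)" by (auto simp: minus_eq)
  then show "s \<in> S" by (auto simp: a_l_coset_def l_coset_def)
qed

lemma kernel_subset: "a_kernel R SR \<phi> \<subseteq> I"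
proof
  fix r assume ker: "r \<in> a_kernel R SR \<phi>"
  then have r: "r \<in> carrier R" unfolding a_kernel_def' by blast
  obtain t where t: "t \<in> S" "t \<otimes> r = \<zero>" using ker mem_kernel_iff[OF r] by blast
  then obtain b where b: "b \<in> I" "t = \<one> \<ominus> b" using mem_S_iff by blast
  have "r = t \<otimes> r \<oplus> b \<otimes> r" unfolding b(2) using r Icarr[OF b(1)] by algebra
  also have "\<dots> = b \<otimes> r" using t(2) r Icarr[OF b(1)] by simp
  finally show "r \<in> I" using I_r_closed[OF b(1) r] by simp
qed

lemma prime_disjoint:
  assumes P: "primeideal P R" and "I \<subseteq> P"
  shows "P \<inter> S = {}"
proof -
  interpret P: primeideal P R by fact
  have "\<one> \<ominus> b \<notin> P" if "b \<in> I" for b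
  proof
    assume "\<one> \<ominus> b \<in> P"
    moreover have "\<one> = (\<one> \<ominus> b) \<oplus> b" using Icarr[OF that] by algebra
    ultimately have "\<one> \<in> P" using that assms(2) P.a_closed by (metis subsetD)
    then show False using P.one_imp_carrier P.I_notcarr by simp
  qed
  then show ?thesis using mem_S_iff by auto
qed

text \<open>
  Powers of \<open>1 - b\<close> stay in \<open>1 + I\<close>, so nilpotency of \<open>a (1 - b)\<close> puts a power of \<open>a\<close> in the
  kernel of the canonical map. Conversely, if \<open>1 - b\<close> annihilates \<open>a\<^sup>n\<close>, then so does
  \<open>(1 - b)\<^sup>n\<close>.
\<close>

lemma N_pure_iff_map_nilpotent: "N_pure_ideal I R \<longleftrightarrow> \<phi> ` I \<subseteq> nilradical SR"
proof -
  have "(\<exists>b\<in>I. a \<otimes> (\<one> \<ominus> b) \<in> nilradical R) \<longleftrightarrow> \<phi> a \<in> nilradical SR" if a: "a \<in> I" for a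
  proof
    have ac: "a \<in> carrier R" using Icarr[OF a] .
    {
      assume "\<exists>b\<in>I. a \<otimes> (\<one> \<ominus> b) \<in> nilradical R"
      then obtain s n where s: "s \<in> S" and n: "n > (0::nat)" "(a \<otimes> s) [^] n = \<zero>"
        by (auto simp: mem_S_iff nilradical_def)
      have "s [^] m \<in> S" for m :: nat using s by (induction m) auto
      moreover have "s [^] n \<otimes> a [^] n = \<zero>"
        using n(2) s ac by (simp add: nat_pow_distrib m_comm)
      ultimately have "a [^] n \<in> a_kernel R SR \<phi>" using ac by (auto simp: mem_kernel_iff)
      then show "\<phi> a \<in> nilradical SR"
        using ac n(1) by (auto simp: map_mem_nilradical_iff radical_ideal_def)
    }
    assume "\<phi> a \<in> nilradical SR"
    then obtain n where n: "n > (0::nat)" "a [^] n \<in> a_kernel R SR \<phi>"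
      using ac by (auto simp: map_mem_nilradical_iff radical_ideal_def)
    then obtain b where b: "b \<in> I" "(\<one> \<ominus> b) \<otimes> a [^] n = \<zero>"
      using ac by (auto simp: mem_kernel_iff mem_S_iff)
    have bc: "\<one> \<ominus> b \<in> carrier R" using Icarr[OF b(1)] by simp
    obtain m where m: "n = Suc m" using n(1) by (cases n) auto
    have "(a \<otimes> (\<one> \<ominus> b)) [^] n = (\<one> \<ominus> b) [^] m \<otimes> ((\<one> \<ominus> b) \<otimes> a [^] n)"
      using ac bc unfolding nat_pow_distrib[OF ac bc] by (simp add: m m_ac)
    then have "(a \<otimes> (\<one> \<ominus> b)) [^] n = \<zero>" using b bc by simp
    then show "\<exists>b\<in>I. a \<otimes> (\<one> \<ominus> b) \<in> nilradical R"
      using b(1) n(1) ac bc by (auto simp: nilradical_def)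
  qed
  then show ?thesis by (auto simp: N_pure_ideal_def is_ideal)
qed

section \<open>The equivalences\<close>

text \<open>
  The nilradical is contained in every prime and is the intersection of all of them, so the
  elements of \<open>I\<close> become nilpotent iff each prime of the localization contains their images.
\<close>

lemma N_pure_iff_spectrum:
  "N_pure_ideal I R \<longleftrightarrow>
    prime_spectrum SR = {localization_ideal R S P | P. P \<in> prime_spectrum R \<and> I \<subseteq> P}"
proof
  assume "N_pure_ideal I R"
  then have nil: "\<phi> ` I \<subseteq> nilradical SR" by (simp add: N_pure_iff_map_nilpotent)
  show "prime_spectrum SR = {localization_ideal R S P | P. P \<in> prime_spectrum R \<and> I \<subseteq> P}"
  proof (intro equalityI subsetI)
    fix Q assume "Q \<in> prime_spectrum SR"
    then have Q: "primeideal Q SR" by (simp add: prime_spectrum_def)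
    interpret Q: primeideal Q SR by fact
    let ?P = "{r \<in> carrier R. \<phi> r \<in> Q}"
    have "nilradical SR \<subseteq> Q"
      unfolding nilradical_eq_radical_zero L.radical_ideal_eq_Inter_primes[OF L.zeroideal]
      using Q Q.zero_closed by blast
    then have "I \<subseteq> ?P" using nil Icarr by auto
    moreover have "primeideal ?P R" using \<phi>.primeideal_vimage[OF is_cring Q] .
    moreover have "Q = localization_ideal R S ?P"
      using extension_of_contraction[OF Q.is_ideal] by simp
    ultimately show "Q \<in> {localization_ideal R S P | P. P \<in> prime_spectrum R \<and> I \<subseteq> P}"
      unfolding prime_spectrum_def by blast
  next
    fix Q assume "Q \<in> {localization_ideal R S P | P. P \<in> prime_spectrum R \<and> I \<subseteq> P}"
    then obtain P where "primeideal P R" "I \<subseteq> P" "Q = localization_ideal R S P"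
      unfolding prime_spectrum_def by blast
    then show "Q \<in> prime_spectrum SR"
      using primeideal_extension prime_disjoint unfolding prime_spectrum_def by simp
  qed
next
  assume spec: "prime_spectrum SR =
    {localization_ideal R S P | P. P \<in> prime_spectrum R \<and> I \<subseteq> P}"
  have "\<phi> ` I \<subseteq> Q" if "primeideal Q SR" for Q
  proof -
    from that have "Q \<in> prime_spectrum SR" by (simp add: prime_spectrum_def)
    then obtain P where P: "primeideal P R" "I \<subseteq> P" "Q = localization_ideal R S P"
      unfolding spec by (auto simp: prime_spectrum_def)
    have "\<phi> ` P \<subseteq> carrier SR" using ideal.Icarr[OF primeideal.axioms(1)[OF P(1)]] by auto
    then have "\<phi> ` P \<subseteq> Q" unfolding P(3) localization_ideal_def by (rule L.genideal_self)
    then show "\<phi> ` I \<subseteq> Q" using P(2) by blast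
  qed
  moreover have "\<phi> ` I \<subseteq> carrier SR" using Icarr by auto
  ultimately show "N_pure_ideal I R"
    unfolding N_pure_iff_map_nilpotent nilradical_eq_radical_zero
      L.radical_ideal_eq_Inter_primes[OF L.zeroideal] by blast
qed

text \<open>
  By \<open>kernel_subset\<close> only the inclusion of \<open>I\<close> in the radical of the kernel carries information.
\<close>

lemma N_pure_iff_radical_kernel:
  "N_pure_ideal I R \<longleftrightarrow> radical_ideal R I = radical_ideal R (a_kernel R SR \<phi>)"
proof -
  have "radical_ideal R (a_kernel R SR \<phi>) \<subseteq> radical_ideal R I"
    using kernel_subset by (auto simp: radical_ideal_def)
  moreover have "N_pure_ideal I R \<longleftrightarrow> I \<subseteq> radical_ideal R (a_kernel R SR \<phi>)"
    unfolding N_pure_iff_map_nilpotent using Icarr by (auto simp: map_mem_nilradical_iff)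
  ultimately show ?thesis
    using radical_subset_radical_iff[OF is_ideal \<phi>.kernel_is_ideal] by blast
qed

text \<open>
  The contraction of the nilradical is the radical of the kernel. If \<open>I\<close> is N-pure it
  equals the radical of \<open>I\<close>, whose extension is then the nilradical again.
\<close>

lemma N_pure_iff_nilradical:
  "N_pure_ideal I R \<longleftrightarrow> nilradical SR = localization_ideal R S (radical_ideal R I)"
proof
  assume "N_pure_ideal I R"
  then have rad: "radical_ideal R I = radical_ideal R (a_kernel R SR \<phi>)"
    by (rule N_pure_iff_radical_kernel[THEN iffD1])
  then have "radical_ideal R I = {r \<in> carrier R. \<phi> r \<in> nilradical SR}"
    by (simp only: contraction_nilradical)
  then show "nilradical SR = localization_ideal R S (radical_ideal R I)"
    by (simp only: extension_of_contraction[OF L.ideal_nilradical])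
next
  assume eq: "nilradical SR = localization_ideal R S (radical_ideal R I)"
  have "\<phi> ` radical_ideal R I \<subseteq> carrier SR" by (auto simp: radical_ideal_def)
  then have "\<phi> ` radical_ideal R I \<subseteq> nilradical SR"
    unfolding eq localization_ideal_def by (rule L.genideal_self)
  then show "N_pure_ideal I R"
    unfolding N_pure_iff_map_nilpotent using ideal_subset_radical[OF is_ideal] by blast
qed

text \<open>
  For an N-pure \<open>I\<close>, the map from \<open>R\<close> to the localization modulo nilpotents is onto with kernel
  the radical of \<open>I\<close>, and the first isomorphism theorem applies. Conversely, an isomorphism that
  is compatible with the structure homomorphisms forces this map to vanish on \<open>I\<close>.
\<close>

lemma N_pure_iff_algebra_isomorphic:
  "N_pure_ideal I R \<longleftrightarrow>
    algebra_isomorphic R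
      (SR Quot nilradical SR) (\<lambda>r. nilradical SR +>\<^bsub>SR\<^esub> \<phi> r)
      (R Quot radical_ideal R I) (\<lambda>r. radical_ideal R I +> r)"
proof -
  interpret N: ideal "nilradical SR" SR by (rule L.ideal_nilradical)
  interpret RI: ideal "radical_ideal R I" R by (rule ideal_radical_ideal[OF is_ideal])
  let ?\<alpha> = "\<lambda>r. nilradical SR +>\<^bsub>SR\<^esub> \<phi> r"
  have "?\<alpha> = (+>\<^bsub>SR\<^esub>) (nilradical SR) \<circ> \<phi>" by auto
  then have "?\<alpha> \<in> ring_hom R (SR Quot nilradical SR)"
    using ring_hom_trans[OF localization_map_hom N.rcos_ring_hom] by simp
  then interpret \<alpha>: ring_hom_ring R "SR Quot nilradical SR" ?\<alpha>
    by (rule ring_hom_ringI2[OF ring_axioms N.quotient_is_ring])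
  have zero: "?\<alpha> r = \<zero>\<^bsub>SR Quot nilradical SR\<^esub> \<longleftrightarrow> \<phi> r \<in> nilradical SR" if "r \<in> carrier R" for r
    using N.a_rcos_const[of "\<phi> r"] N.rcos_const_imp_mem[OF \<phi>.hom_closed[OF that]]
    by (auto simp only: FactRing_def ring.simps)
  show ?thesis
  proof
    assume "N_pure_ideal I R"
    then have nil: "\<phi> ` I \<subseteq> nilradical SR"
      and rad: "radical_ideal R I = radical_ideal R (a_kernel R SR \<phi>)"
      using N_pure_iff_map_nilpotent N_pure_iff_radical_kernel by auto
    have "a_kernel R (SR Quot nilradical SR) ?\<alpha> = {r \<in> carrier R. \<phi> r \<in> nilradical SR}"
      unfolding a_kernel_def' by (intro Collect_cong conj_cong refl zero)
    then have kernel: "a_kernel R (SR Quot nilradical SR) ?\<alpha> = radical_ideal R I"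
      by (simp only: rad contraction_nilradical)
    have "carrier (SR Quot nilradical SR) \<subseteq> ?\<alpha> ` carrier R"
    proof
      fix X assume "X \<in> carrier (SR Quot nilradical SR)"
      then obtain x where x: "x \<in> carrier SR" "X = nilradical SR +>\<^bsub>SR\<^esub> x"
        unfolding FactRing_simps by auto
      obtain r s where rs: "r \<in> carrier R" "s \<in> S" "x = frac R S r s"
        using x(1) by (rule localization_cases)
      obtain b where b: "b \<in> I" "s = \<one> \<ominus> b" using rs(2) mem_S_iff by blast
      have bc: "b \<in> carrier R" using Icarr[OF b(1)] .
      \<comment> \<open>Writing \<open>s = 1 - b\<close> exhibits \<open>r\<close> as a lift of \<open>x = r / s\<close>: the two differ by \<open>b x\<close>,
        which is nilpotent.\<close>
      have "\<phi> b \<otimes>\<^bsub>SR\<^esub> x \<oplus>\<^bsub>SR\<^esub> \<phi> r = x"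
      proof -
        have "\<phi> b \<otimes>\<^bsub>SR\<^esub> x \<oplus>\<^bsub>SR\<^esub> \<phi> r = frac R S (b \<otimes> r \<oplus> s \<otimes> r) s"
          unfolding rs(3) localization_map_def using rs(1,2) bc
          by (simp add: localization_mult localization_add)
        moreover have "b \<otimes> r \<oplus> s \<otimes> r = r" unfolding b(2) using bc rs(1) by algebra
        ultimately show ?thesis using rs(3) by simp
      qed
      moreover have "\<phi> b \<otimes>\<^bsub>SR\<^esub> x \<in> nilradical SR"
        using N.I_r_closed[OF _ x(1)] nil b(1) by blast
      ultimately have "x \<in> nilradical SR +>\<^bsub>SR\<^esub> \<phi> r"
        unfolding a_r_coset_def' by blast
      then have "?\<alpha> r = X"
        unfolding x(2) by (rule N.a_repr_independence'[OF _ \<phi>.hom_closed[OF rs(1)]])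
      then show "X \<in> ?\<alpha> ` carrier R" using rs(1) by blast
    qed
    then have "?\<alpha> ` carrier R = carrier (SR Quot nilradical SR)" using \<alpha>.hom_closed by blast
    from \<alpha>.algebra_isomorphic_Quot_kernel[OF this]
    show "algebra_isomorphic R (SR Quot nilradical SR) ?\<alpha>
      (R Quot radical_ideal R I) (\<lambda>r. radical_ideal R I +> r)"
      unfolding kernel .
  next
    assume "algebra_isomorphic R (SR Quot nilradical SR) ?\<alpha>
      (R Quot radical_ideal R I) (\<lambda>r. radical_ideal R I +> r)"
    then obtain f where f: "f \<in> ring_iso (SR Quot nilradical SR) (R Quot radical_ideal R I)"
      and comm: "\<And>r. r \<in> carrier R \<Longrightarrow> f (?\<alpha> r) = radical_ideal R I +> r"
      unfolding algebra_isomorphic_def by blast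
    have inj: "inj_on f (carrier (SR Quot nilradical SR))"
      using f by (simp add: ring_iso_def bij_betw_def)
    have "\<phi> a \<in> nilradical SR" if "a \<in> I" for a
    proof -
      have a: "a \<in> carrier R" "a \<in> radical_ideal R I"
        using that Icarr ideal_subset_radical[OF is_ideal] by auto
      have z: "\<zero> \<in> carrier R" by simp
      have "f (?\<alpha> a) = f (?\<alpha> \<zero>)"
        unfolding comm[OF a(1)] comm[OF z] using RI.a_rcos_const[OF a(2)]
          RI.a_rcos_const[OF RI.zero_closed] by (rule trans[OF _ sym])
      then have "?\<alpha> a = ?\<alpha> \<zero>"
        using inj_onD[OF inj _ \<alpha>.hom_closed[OF a(1)] \<alpha>.hom_closed[OF z]] by blast
      then show ?thesis using zero[OF a(1)] \<alpha>.hom_zero by simp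
    qed
    then show "N_pure_ideal I R" by (auto simp: N_pure_iff_map_nilpotent)
  qed
qed

end

theorem theorem3p7:
  fixes R :: "('a, 'b) ring_scheme" (structure) and I S :: "'a set"
  assumes "cring R" and "ideal I R" and "S = \<one> <+ I"
  defines "SR \<equiv> localization R S"
    and "\<phi> \<equiv> localization_map R S"
    and "NSR \<equiv> nilradical (localization R S)"
    and "rI \<equiv> radical_ideal R I"
  shows
    "(N_pure_ideal I R \<longleftrightarrow>
        prime_spectrum SR = {localization_ideal R S P | P. P \<in> prime_spectrum R \<and> I \<subseteq> P})
     \<and> (N_pure_ideal I R \<longleftrightarrow> NSR = localization_ideal R S rI)
     \<and> (N_pure_ideal I R \<longleftrightarrow> rI = radical_ideal R (a_kernel R SR \<phi>))
     \<and> (N_pure_ideal I R \<longleftrightarrow>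
        algebra_isomorphic R
          (SR Quot NSR) (\<lambda>r. NSR +>\<^bsub>SR\<^esub> \<phi> r)
          (R Quot rI) (\<lambda>r. rI +> r))"
proof -
  interpret one_plus_ideal R I using assms(1,2) by (rule one_plus_ideal.intro)
  show ?thesis
    unfolding SR_def \<phi>_def NSR_def rI_def \<open>S = \<one> <+ I\<close>
    using N_pure_iff_spectrum N_pure_iff_nilradical N_pure_iff_radical_kernel
      N_pure_iff_algebra_isomorphic by blast
qed

end
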